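(* Let $r>1$ be real. Then $$\text{(I)}\qquad\left(\frac{n\sum_{i=1}^{n-1}i^r}{(n-1)\sum_{i=1}^{n}i^r}\right)^{1/r}<\frac{n}{n+1}<\left(\frac{(n+2)\sum_{i=1}^{n}i^r}{(n+1)\sum_{i=1}^{n+1}i^r}\right)^{1/r},$$ where in the left-hand inequality $n\ge2$ is any integer and in the right-hand inequality $n\ge1$ is any integer; equivalently, for every integer $n\ge1$, $$\text{(II)}\qquad\frac{n}{n+1}\left(1+\frac{1}{n(n+2)}\right)^{1/r}<\left(\frac{(n+1)\sum_{i=1}^{n}i^r}{n\sum_{i=1}^{n+1}i^r}\right)^{1/r}<\frac{n+1}{n+2}.$$ If $0<r<1$, all inequalities in (I) and (II) are reversed. *)

theory Defs
  imports Complex_Main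
begin

end

theory Submission
  imports Defs
begin

text \<open>
  Put \<open>S n = (\<Sum>i=1..n. i powr r)\<close>. Cleared of roots and solved for \<open>S n\<close>, the two inequalities
  are an upper bound \<open>S n < U n\<close> and a lower bound \<open>L n < S n\<close> (for \<open>r > 1\<close>) with explicit
  \<open>U\<close> and \<open>L\<close> vanishing at \<open>0\<close>. It suffices to compare increments, and these comparisons
  are two-point Jensen inequalities for \<open>x powr r\<close>, obtained by adding two instances of
  Bernoulli's inequality whose linear terms cancel. The sign \<open>sgn (r - 1)\<close> is carried along
  in order to treat \<open>r > 1\<close> and \<open>0 < r < 1\<close> simultaneously.
\<close>

section \<open>Strict Bernoulli and the two Jensen inequalities derived from it\<close>

lemma Bernoulli_powr_strict:
  fixes r y :: real
  assumes r: "r > 0" "r \<noteq> 1" and y: "y \<ge> 0" "y \<noteq> 1"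
  shows "sgn (r - 1) * (1 + r * (y - 1)) < sgn (r - 1) * y powr r"
\<comment> \<open>The left side is \<open>- \<bar>r - 1\<bar>\<close> at \<open>y = 0\<close>. The
  case is split off because the mean value theorem is applied on a closed interval ending at
  \<open>y\<close>, and the derivative formula holds only at positive points.\<close>
proof (cases "y = 0")
  case True
  then show ?thesis using r by (auto simp: sgn_if)
next
  case False
  with y have "y > 0" by simp
  have deriv: "((\<lambda>t. t powr r) has_real_derivative r * z powr (r - 1)) (at z)" if "z > 0" for z
    using that by (auto intro!: derivative_eq_intros)
  \<comment> \<open>The mean value theorem gives
    \<open>y powr r - 1 = (y - 1) * (r * z powr (r - 1))\<close> with \<open>z\<close> strictly
    between \<open>y\<close> and \<open>1\<close>. The sign of \<open>z powr (r - 1) - 1\<close> is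
    that of \<open>(r - 1) * (y - 1)\<close>, so replacing this power by \<open>1\<close> changes
    the product in the direction of \<open>r - 1\<close>.\<close>
  have "sgn (r - 1) * (r * (y - 1)) < sgn (r - 1) * (y powr r - 1)"
  proof (cases "y < 1")
    case True
    obtain z where z: "y < z" "z < 1" "1 powr r - y powr r = (1 - y) * (r * z powr (r - 1))"
      using MVT2[OF True, of "\<lambda>t. t powr r" "\<lambda>z. r * z powr (r - 1)"] deriv \<open>y > 0\<close> by auto
    have "sgn (r - 1) * z powr (r - 1) < sgn (r - 1)"
    proof (cases "r > 1")
      case True
      then show ?thesis using powr_less_mono2[of "r - 1" z 1] z \<open>y > 0\<close> by simp
    next
      case False
      then show ?thesis using powr_less_mono2_neg[of "r - 1" z 1] z \<open>y > 0\<close> r by (simp add: sgn_if)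
    qed
    then have "((1 - y) * r) * (sgn (r - 1) * z powr (r - 1)) < ((1 - y) * r) * sgn (r - 1)"
      using True r by (intro mult_strict_left_mono) auto
    moreover have eq: "y powr r - 1 = (y - 1) * (r * z powr (r - 1))"
      using z(3) by (simp add: algebra_simps)
    ultimately show ?thesis unfolding eq by (simp add: algebra_simps)
  next
    case False
    with y have "1 < y" by simp
    obtain z where z: "1 < z" "z < y" "y powr r - 1 powr r = (y - 1) * (r * z powr (r - 1))"
      using MVT2[OF \<open>1 < y\<close>, of "\<lambda>t. t powr r" "\<lambda>z. r * z powr (r - 1)"] deriv by auto
    have "sgn (r - 1) < sgn (r - 1) * z powr (r - 1)"
    proof (cases "r > 1")
      case True
      then show ?thesis using powr_less_mono2[of "r - 1" 1 z] z by simp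
    next
      case False
      then show ?thesis using powr_less_mono2_neg[of "r - 1" 1 z] z r by (simp add: sgn_if)
    qed
    then have "((y - 1) * r) * sgn (r - 1) < ((y - 1) * r) * (sgn (r - 1) * z powr (r - 1))"
      using \<open>1 < y\<close> r by (intro mult_strict_left_mono) auto
    moreover have eq: "y powr r - 1 = (y - 1) * (r * z powr (r - 1))"
      using z(3) by (simp add: algebra_simps)
    ultimately show ?thesis unfolding eq by (simp add: algebra_simps)
  qed
  then show ?thesis by (simp add: algebra_simps)
qed

text \<open>Bernoulli at the points \<open>y\<close> and \<open>z\<close> with weights
  \<open>x + 1\<close> and \<open>1\<close>: their weighted mean is \<open>1\<close>, so the linear
  terms cancel and the total weight \<open>x + 2\<close> remains on the left. Multiplying by
  \<open>(x + 1) powr r * (x + 3) powr r\<close> clears the denominators of \<open>y\<close> and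
  \<open>z\<close>.\<close>

lemma Jensen_powr_upper:
  fixes r x :: real
  assumes r: "r > 0" "r \<noteq> 1" and x: "x \<ge> 0"
  shows "sgn (r - 1) * ((x + 2) * (x + 1) powr r * (x + 3) powr r)
    < sgn (r - 1) * ((x + 1) * ((x + 2) powr r)\<^sup>2 + (x + 1) powr r * (x + 2) powr r)"
proof -
  let ?s = "sgn (r - 1)"
  define y z where "y = (x + 2) * (x + 2) / ((x + 1) * (x + 3))" and "z = (x + 2) / (x + 3)"
  have lin: "(x + 1) * (y - 1) + (z - 1) = 0"
    using x by (simp add: y_def z_def divide_simps) (simp add: algebra_simps)
  have "y \<noteq> 1" "z \<noteq> 1" "y \<ge> 0" "z \<ge> 0"
    using x by (auto simp: y_def z_def divide_simps) (auto simp: algebra_simps)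
  then have "(x + 1) * (?s * (1 + r * (y - 1))) + ?s * (1 + r * (z - 1))
      < (x + 1) * (?s * y powr r) + ?s * z powr r"
    using r x by (intro add_strict_mono mult_strict_left_mono Bernoulli_powr_strict) auto
  also have "(x + 1) * (?s * (1 + r * (y - 1))) + ?s * (1 + r * (z - 1))
      = ?s * (x + 2 + r * ((x + 1) * (y - 1) + (z - 1)))"
    by (simp add: algebra_simps)
  also have "\<dots> = ?s * (x + 2)" by (simp add: lin)
  finally have "?s * (x + 2) < ?s * ((x + 1) * y powr r + z powr r)"
    by (simp add: algebra_simps)
  then have "(x + 1) powr r * (x + 3) powr r * (?s * (x + 2))
      < (x + 1) powr r * (x + 3) powr r * (?s * ((x + 1) * y powr r + z powr r))"
    by (rule mult_strict_left_mono) (use x in auto)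
  moreover have "(x + 1) powr r * (x + 3) powr r * ((x + 1) * y powr r + z powr r)
      = (x + 1) * ((x + 2) powr r)\<^sup>2 + (x + 1) powr r * (x + 2) powr r"
  proof -
    have "y powr r = ((x + 2) powr r)\<^sup>2 / ((x + 1) powr r * (x + 3) powr r)"
      "z powr r = (x + 2) powr r / (x + 3) powr r"
      using x by (simp_all add: y_def z_def powr_divide powr_mult power2_eq_square)
    then show ?thesis using x by (simp add: field_simps)
  qed
  ultimately show ?thesis by (simp only: mult_ac)
qed

text \<open>The same argument with weights \<open>1\<close> at \<open>y\<close> and
  \<open>x + 1\<close> at \<open>z\<close>, cleared by
  \<open>(x + 1) powr r * (x + 1) powr r\<close>. For \<open>x = 0\<close> the point
  \<open>z\<close> is \<open>0\<close>, which is why Bernoulli's inequality is proved there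
  too.\<close>

lemma Jensen_powr_lower:
  fixes r x :: real
  assumes r: "r > 0" "r \<noteq> 1" and x: "x \<ge> 0"
  shows "sgn (r - 1) * ((x + 2) * ((x + 1) powr r)\<^sup>2)
    < sgn (r - 1) * ((x + 1) powr r * (x + 2) powr r + (x + 1) * x powr r * (x + 2) powr r)"
proof -
  let ?s = "sgn (r - 1)"
  define y z where "y = (x + 2) / (x + 1)" and "z = x * (x + 2) / ((x + 1) * (x + 1))"
  have lin: "(y - 1) + (x + 1) * (z - 1) = 0"
    using x by (simp add: y_def z_def divide_simps) (simp add: algebra_simps)
  have "y \<noteq> 1" "z \<noteq> 1" "y \<ge> 0" "z \<ge> 0"
    using x by (auto simp: y_def z_def divide_simps) (auto simp: algebra_simps)
  then have "?s * (1 + r * (y - 1)) + (x + 1) * (?s * (1 + r * (z - 1)))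
      < ?s * y powr r + (x + 1) * (?s * z powr r)"
    using r x by (intro add_strict_mono mult_strict_left_mono Bernoulli_powr_strict) auto
  also have "?s * (1 + r * (y - 1)) + (x + 1) * (?s * (1 + r * (z - 1)))
      = ?s * (x + 2 + r * ((y - 1) + (x + 1) * (z - 1)))"
    by (simp add: algebra_simps)
  also have "\<dots> = ?s * (x + 2)" by (simp add: lin)
  finally have "?s * (x + 2) < ?s * (y powr r + (x + 1) * z powr r)"
    by (simp add: algebra_simps)
  then have "(x + 1) powr r * (x + 1) powr r * (?s * (x + 2))
      < (x + 1) powr r * (x + 1) powr r * (?s * (y powr r + (x + 1) * z powr r))"
    by (rule mult_strict_left_mono) (use x in auto)
  moreover have "(x + 1) powr r * (x + 1) powr r * (y powr r + (x + 1) * z powr r)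
      = (x + 1) powr r * (x + 2) powr r + (x + 1) * x powr r * (x + 2) powr r"
  proof -
    have "y powr r = (x + 2) powr r / (x + 1) powr r"
      "z powr r = x powr r * (x + 2) powr r / ((x + 1) powr r * (x + 1) powr r)"
      using x by (simp_all add: y_def z_def powr_divide powr_mult)
    then show ?thesis using x by (simp add: field_simps)
  qed
  ultimately show ?thesis by (simp only: power2_eq_square mult_ac)
qed

section \<open>Bounds for the power sums by comparison of increments\<close>

lemma sum_less_telescope:
  fixes f g :: "nat \<Rightarrow> real"
  assumes "g 0 = 0" and step: "\<And>n. g n + f (Suc n) < g (Suc n)" and "n \<ge> 1"
  shows "(\<Sum>i=1..n. f i) < g n"
  using \<open>n \<ge> 1\<close>
proof (induction n rule: nat_induct_at_least)
  case base
  then show ?case using step[of 0] \<open>g 0 = 0\<close> by simp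
next
  case (Suc n)
  then show ?case using step[of n] by simp
qed

lemma sum_powr_upper:
  fixes r :: real and n :: nat
  assumes r: "r > 0" "r \<noteq> 1" and n: "n \<ge> 1"
  defines "S \<equiv> \<lambda>n. \<Sum>i=1..n. real i powr r"
  shows "sgn (r - 1) * ((real n + 1) * S n / (real n * S (n + 1)))
    < sgn (r - 1) * ((real n + 1) / (real n + 2)) powr r"
proof -
  let ?s = "sgn (r - 1)"
  define p where "p = (\<lambda>n::nat. real n powr r)"
  \<comment> \<open>With \<open>S (n + 1) = S n + p (n + 1)\<close>, clearing denominators in the
    goal leaves \<open>K n\<close> as the coefficient of \<open>S n\<close>; the solution of the
    corresponding equation is \<open>U n\<close>.\<close>
  define K where "K = (\<lambda>n. (real n + 1) * p (n + 2) - real n * p (n + 1))"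
  define U where "U = (\<lambda>n. real n * (p (n + 1))\<^sup>2 / K n)"
  have p_pos: "p (Suc n) > 0" for n by (simp add: p_def)
  have K_pos: "K n > 0" for n
  proof -
    have "p (n + 1) < p (n + 2)"
      unfolding p_def using r by (intro powr_less_mono2) auto
    then have "real n * p (n + 1) \<le> real n * p (n + 2)" by (intro mult_left_mono) auto
    then show ?thesis using p_pos[of "Suc n"] by (simp add: K_def algebra_simps)
  qed
  have step: "?s * U n + ?s * p (Suc n) < ?s * U (Suc n)" for n
  proof -
    let ?a = "p (n + 1)" and ?b = "p (n + 2)" and ?c = "p (n + 3)"
    have "?s * ((real n + 2) * ?a * ?c) < ?s * ((real n + 1) * ?b\<^sup>2 + ?a * ?b)"
      using Jensen_powr_upper[OF r, of "real n"] by (simp add: p_def add.commute)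
    \<comment> \<open>This is the whole increment comparison:
      \<open>U n + ?a = (real n + 1) * ?a * ?b / K n\<close> and
      \<open>U (Suc n) = (real n + 1) * ?b * ?b / K (Suc n)\<close>, so both sides share the
      positive factor used next.\<close>
    then have "?s * (K (Suc n) * ?a) < ?s * (K n * ?b)"
      by (simp add: K_def algebra_simps power2_eq_square numeral_3_eq_3)
    then have "(real n + 1) * ?b / (K n * K (Suc n)) * (?s * (K (Suc n) * ?a))
        < (real n + 1) * ?b / (K n * K (Suc n)) * (?s * (K n * ?b))"
      by (rule mult_strict_left_mono) (use K_pos p_pos in auto)
    moreover have "?s * U n + ?s * ?a = (real n + 1) * ?b / (K n * K (Suc n)) * (?s * (K (Suc n) * ?a))"
    proof -
      have "U n + ?a = (real n + 1) * ?a * ?b / K n"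
        unfolding U_def using K_pos[of n]
        by (simp add: divide_simps) (simp add: K_def algebra_simps power2_eq_square)
      then show ?thesis using K_pos[of "Suc n"] by (simp flip: distrib_left)
    qed
    moreover have "?s * U (Suc n) = (real n + 1) * ?b / (K n * K (Suc n)) * (?s * (K n * ?b))"
      using K_pos[of n] by (simp add: U_def power2_eq_square ac_simps)
    ultimately show ?thesis by simp
  qed
  have "(\<Sum>i=1..n. ?s * p i) < ?s * U n"
    using n step by (intro sum_less_telescope) (auto simp: U_def)
  then have less: "?s * S n < ?s * U n"
    by (simp add: S_def p_def sum_distrib_left)
  let ?a = "p (n + 1)" and ?b = "p (n + 2)"
  have S_Suc: "S (Suc n) = S n + ?a" by (simp add: S_def p_def)
  have S_nonneg: "S n \<ge> 0" unfolding S_def by (intro sum_nonneg) auto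
  have pos: "real n * S (n + 1) * ?b > 0"
    using n S_nonneg p_pos by (auto simp: S_Suc intro!: mult_pos_pos add_nonneg_pos)
  have "K n * (?s * S n) < K n * (?s * U n)"
    using less K_pos by (rule mult_strict_left_mono)
  then have "?s * ((real n + 1) * S n * ?b) < ?s * (?a * (real n * S (n + 1)))"
    using K_pos[of n] by (simp add: U_def S_Suc) (simp add: K_def algebra_simps power2_eq_square)
  then have "?s * ((real n + 1) * S n * ?b) / (real n * S (n + 1) * ?b)
      < ?s * (?a * (real n * S (n + 1))) / (real n * S (n + 1) * ?b)"
    using pos by (rule divide_strict_right_mono)
  moreover have "((real n + 1) / (real n + 2)) powr r = ?a / ?b"
    by (simp add: p_def powr_divide add.commute)
  moreover have "S (Suc n) \<noteq> 0" "?b \<noteq> 0" using pos by auto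
  ultimately show ?thesis using n by simp
qed

lemma sum_powr_lower:
  fixes r :: real and n :: nat
  assumes r: "r > 0" "r \<noteq> 1" and n: "n \<ge> 1"
  defines "S \<equiv> \<lambda>n. \<Sum>i=1..n. real i powr r"
  shows "sgn (r - 1) * (real n / (real n + 1)) powr r
    < sgn (r - 1) * ((real n + 2) * S n / ((real n + 1) * S (n + 1)))"
proof -
  let ?s = "sgn (r - 1)"
  define p where "p = (\<lambda>n::nat. real n powr r)"
  \<comment> \<open>Again \<open>K n\<close> is the coefficient of \<open>S n\<close> in the cleared
    goal and \<open>L n\<close> the value of \<open>S n\<close> at equality. Here
    \<open>L 0 = 0\<close> because \<open>p 0 = 0 powr r = 0\<close>.\<close>
  define K where "K = (\<lambda>n. (real n + 2) * p (n + 1) - (real n + 1) * p n)"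
  define L where "L = (\<lambda>n. (real n + 1) * p n * p (n + 1) / K n)"
  have p_pos: "p (Suc n) > 0" for n by (simp add: p_def)
  have K_pos: "K n > 0" for n
  proof -
    have "p n < p (n + 1)"
      unfolding p_def using r by (intro powr_less_mono2) auto
    then have "(real n + 1) * p n \<le> (real n + 1) * p (n + 1)" by (intro mult_left_mono) auto
    then show ?thesis using p_pos[of n] by (simp add: K_def algebra_simps)
  qed
  \<comment> \<open>The sign is flipped because \<open>sum_less_telescope\<close> bounds a sum from
    above, whereas \<open>L\<close> must lie on the other side of the sum.\<close>
  have step: "- ?s * L n + - ?s * p (Suc n) < - ?s * L (Suc n)" for n
  proof -
    let ?a = "p n" and ?b = "p (n + 1)" and ?c = "p (n + 2)"
    have "?s * ((real n + 2) * ?b\<^sup>2) < ?s * (?b * ?c + (real n + 1) * ?a * ?c)"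
      using Jensen_powr_lower[OF r, of "real n"] by (simp add: p_def add.commute)
    \<comment> \<open>Here \<open>L n + ?b = (real n + 2) * ?b * ?b / K n\<close> and
      \<open>L (Suc n) = (real n + 2) * ?b * ?c / K (Suc n)\<close>, so only this comparison is
      left.\<close>
    then have "?s * (K n * ?c) < ?s * (K (Suc n) * ?b)"
      by (simp add: K_def algebra_simps power2_eq_square)
    then have "(real n + 2) * ?b / (K n * K (Suc n)) * (?s * (K n * ?c))
        < (real n + 2) * ?b / (K n * K (Suc n)) * (?s * (K (Suc n) * ?b))"
      by (rule mult_strict_left_mono) (use K_pos p_pos in auto)
    moreover have "?s * L n + ?s * ?b = (real n + 2) * ?b / (K n * K (Suc n)) * (?s * (K (Suc n) * ?b))"
    proof -
      have "L n + ?b = (real n + 2) * ?b * ?b / K n"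
        unfolding L_def using K_pos[of n]
        by (simp add: divide_simps) (simp add: K_def algebra_simps power2_eq_square)
      then show ?thesis using K_pos[of "Suc n"] by (simp flip: distrib_left)
    qed
    moreover have "?s * L (Suc n) = (real n + 2) * ?b / (K n * K (Suc n)) * (?s * (K n * ?c))"
      using K_pos[of n] by (simp add: L_def ac_simps)
    ultimately show ?thesis by simp
  qed
  have "(\<Sum>i=1..n. - ?s * p i) < - ?s * L n"
    using n step r by (intro sum_less_telescope) (auto simp: L_def p_def)
  then have less: "?s * L n < ?s * S n"
    by (simp add: S_def p_def sum_negf flip: sum_distrib_left)
  let ?a = "p n" and ?b = "p (n + 1)"
  have S_Suc: "S (Suc n) = S n + ?b" by (simp add: S_def p_def)
  have S_nonneg: "S n \<ge> 0" unfolding S_def by (intro sum_nonneg) auto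
  have pos: "(real n + 1) * S (n + 1) * ?b > 0"
    using S_nonneg p_pos by (auto simp: S_Suc intro!: mult_pos_pos add_nonneg_pos)
  have "K n * (?s * L n) < K n * (?s * S n)"
    using less K_pos by (rule mult_strict_left_mono)
  then have "?s * (?a * ((real n + 1) * S (n + 1))) < ?s * ((real n + 2) * S n * ?b)"
    using K_pos[of n] by (simp add: L_def S_Suc) (simp add: K_def algebra_simps)
  then have "?s * (?a * ((real n + 1) * S (n + 1))) / ((real n + 1) * S (n + 1) * ?b)
      < ?s * ((real n + 2) * S n * ?b) / ((real n + 1) * S (n + 1) * ?b)"
    using pos by (rule divide_strict_right_mono)
  moreover have "(real n / (real n + 1)) powr r = ?a / ?b"
    by (simp add: p_def powr_divide add.commute)
  moreover have "S (Suc n) \<noteq> 0" "?b \<noteq> 0" using pos by auto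
  ultimately show ?thesis using n by simp
qed

section \<open>Taking roots and assembling (I) and (II)\<close>

lemma sgn_mult_powr_inverse_mono:
  fixes x y r s :: real
  assumes "r > 0" "x \<ge> 0" "y \<ge> 0" "sgn s * x < sgn s * y"
  shows "sgn s * x powr (1 / r) < sgn s * y powr (1 / r)"
  using assms powr_less_mono2[of "1 / r" x y] powr_less_mono2[of "1 / r" y x]
  by (auto simp: sgn_if split: if_splits)

text \<open>The first two bounds are the \<open>r\<close>-th roots of the bounds on power sums. The
  third is the second one rescaled, so (II) contains nothing beyond (I).\<close>

lemma mean_ratio_bounds:
  fixes r :: real and n :: nat
  assumes r: "r > 0" "r \<noteq> 1" and n: "n \<ge> 1"
  defines "S \<equiv> \<lambda>n. \<Sum>i=1..n. real i powr r" and "s \<equiv> sgn (r - 1)"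
  shows "s * ((real n + 1) * S n / (real n * S (n + 1))) powr (1 / r)
      < s * ((real n + 1) / (real n + 2))" (is ?upper)
    and "s * (real n / (real n + 1))
      < s * ((real n + 2) * S n / ((real n + 1) * S (n + 1))) powr (1 / r)" (is ?lower)
    and "s * (real n / (real n + 1) * (1 + 1 / (real n * (real n + 2))) powr (1 / r))
      < s * ((real n + 1) * S n / (real n * S (n + 1))) powr (1 / r)" (is ?lower')
proof -
  have S: "S k \<ge> 0" for k unfolding S_def by (intro sum_nonneg) auto
  have root: "(x powr r) powr (1 / r) = x" if "x \<ge> 0" for x
    using that r by (simp add: powr_powr)
  show ?upper
    using sgn_mult_powr_inverse_mono[OF r(1) _ _ sum_powr_upper[OF r n]] S
    unfolding S_def s_def by (simp add: root del: One_nat_def)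
  show lower: ?lower
    using sgn_mult_powr_inverse_mono[OF r(1) _ _ sum_powr_lower[OF r n]] S
    unfolding S_def s_def by (simp add: root del: One_nat_def)
  \<comment> \<open>Since \<open>?w = (real n + 1) * (real n + 1) / (real n * (real n + 2))\<close>,
    multiplying by \<open>?w\<close> turns the ratio in \<open>?lower\<close> into the one in
    \<open>?lower'\<close>.\<close>
  let ?w = "1 + 1 / (real n * (real n + 2))"
  have "?w powr (1 / r) * (s * (real n / (real n + 1)))
      < ?w powr (1 / r) * (s * ((real n + 2) * S n / ((real n + 1) * S (n + 1))) powr (1 / r))"
    using lower by (rule mult_strict_left_mono) (simp add: add_pos_nonneg less_imp_neq[symmetric])
  also have "\<dots> = s * (?w * ((real n + 2) * S n / ((real n + 1) * S (n + 1)))) powr (1 / r)"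
    by (simp only: powr_mult mult_ac)
  also have "?w * ((real n + 2) * S n / ((real n + 1) * S (n + 1)))
      = (real n + 1) * S n / (real n * S (n + 1))"
  proof -
    have "?w = (real n + 1) * (real n + 1) / (real n * (real n + 2))"
      using n by (simp add: divide_simps) (simp add: algebra_simps)
    then show ?thesis by simp
  qed
  finally show ?lower' by (simp add: mult_ac)
qed

theorem mainTheorem10:
  fixes r :: real
  shows
    "(r > 1 \<longrightarrow>
        (\<forall>n::nat. n \<ge> 2 \<longrightarrow>
           ((real n * (\<Sum>i=1..n-1. real i powr r))
              / ((real n - 1) * (\<Sum>i=1..n. real i powr r))) powr (1 / r)
           < real n / (real n + 1)) \<and>
        (\<forall>n::nat. n \<ge> 1 \<longrightarrow>
           real n / (real n + 1)
           < (((real n + 2) * (\<Sum>i=1..n. real i powr r))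
                / ((real n + 1) * (\<Sum>i=1..n+1. real i powr r))) powr (1 / r)) \<and>
        (\<forall>n::nat. n \<ge> 1 \<longrightarrow>
           real n / (real n + 1) * (1 + 1 / (real n * (real n + 2))) powr (1 / r)
           < (((real n + 1) * (\<Sum>i=1..n. real i powr r))
                / (real n * (\<Sum>i=1..n+1. real i powr r))) powr (1 / r) \<and>
           (((real n + 1) * (\<Sum>i=1..n. real i powr r))
              / (real n * (\<Sum>i=1..n+1. real i powr r))) powr (1 / r)
           < (real n + 1) / (real n + 2)))
     \<and>
     (0 < r \<and> r < 1 \<longrightarrow>
        (\<forall>n::nat. n \<ge> 2 \<longrightarrow>
           ((real n * (\<Sum>i=1..n-1. real i powr r))
              / ((real n - 1) * (\<Sum>i=1..n. real i powr r))) powr (1 / r)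
           > real n / (real n + 1)) \<and>
        (\<forall>n::nat. n \<ge> 1 \<longrightarrow>
           real n / (real n + 1)
           > (((real n + 2) * (\<Sum>i=1..n. real i powr r))
                / ((real n + 1) * (\<Sum>i=1..n+1. real i powr r))) powr (1 / r)) \<and>
        (\<forall>n::nat. n \<ge> 1 \<longrightarrow>
           real n / (real n + 1) * (1 + 1 / (real n * (real n + 2))) powr (1 / r)
           > (((real n + 1) * (\<Sum>i=1..n. real i powr r))
                / (real n * (\<Sum>i=1..n+1. real i powr r))) powr (1 / r) \<and>
           (((real n + 1) * (\<Sum>i=1..n. real i powr r))
              / (real n * (\<Sum>i=1..n+1. real i powr r))) powr (1 / r)
           > (real n + 1) / (real n + 2)))"
proof ((rule conjI; rule impI), goal_cases)
  case 1
  then have sgn_less: "sgn (r - 1) * a < sgn (r - 1) * b \<longleftrightarrow> a < b" for a b :: real by simp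
  from 1 have "0 < r" "r \<noteq> 1" by auto
  note bounds = mean_ratio_bounds[OF this, unfolded sgn_less]
  \<comment> \<open>The left inequality of (I) is the first bound at \<open>n - 1\<close>, which is
    at least \<open>1\<close> exactly when \<open>n \<ge> 2\<close>.\<close>
  have "((real n * (\<Sum>i=1..n-1. real i powr r))
      / ((real n - 1) * (\<Sum>i=1..n. real i powr r))) powr (1 / r) < real n / (real n + 1)"
    if "n \<ge> 2" for n
    using bounds(1)[of "n - 1"] that by (simp add: of_nat_diff add.commute del: One_nat_def)
  with bounds show ?case by (intro conjI allI impI)
next
  case 2
  \<comment> \<open>Now the sign is \<open>-1\<close>, so the same bounds give all the reversed
    inequalities.\<close>
  then have sgn_less: "sgn (r - 1) * a < sgn (r - 1) * b \<longleftrightarrow> b < a" for a b :: real by simp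
  from 2 have "0 < r" "r \<noteq> 1" by auto
  note bounds = mean_ratio_bounds[OF this, unfolded sgn_less]
  have "((real n * (\<Sum>i=1..n-1. real i powr r))
      / ((real n - 1) * (\<Sum>i=1..n. real i powr r))) powr (1 / r) > real n / (real n + 1)"
    if "n \<ge> 2" for n
    using bounds(1)[of "n - 1"] that by (simp add: of_nat_diff add.commute del: One_nat_def)
  with bounds show ?case by (intro conjI allI impI)
qed

end
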